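(* Let $\mathbf{b},\mathbf{c},\boldsymbol{\alpha}\in\mathbb{R}^N_+\setminus\{\mathbf{0}\}$ and $\boldsymbol{\beta}\in\mathbb{R}^N_+$, let $\Omega=[0,1]^N$, and for $\mathbf{y}\in\mathbb{R}^N_+$ put $Y=Y(\mathbf{y}):=L_\beta+\mathrm{diag}(\mathbf{y}\diamond\boldsymbol{\alpha})$. Consider $f:\mathbb{R}^N_+\to\mathbb{R}\cup\{\infty\}$ given by $f(\mathbf{y})=\mathbf{b}^{\mathsf T}\,Y^{-1}\mathbf{c}$. Then $f$ is positive, convex and decreasing on $\Omega$. It is smooth on the interior of $\Omega$, with gradient $$\nabla f(\mathbf{y})=-(Y^{-\mathsf T}\mathbf{b})\diamond\boldsymbol{\alpha}\diamond(Y^{-1}\mathbf{c})$$ and Hessian $$\mathbf{H}(\mathbf{y})=H(\mathbf{y})+H(\mathbf{y})^{\mathsf T},\qquad H(\mathbf{y}):=\mathrm{diag}\big(\boldsymbol{\alpha}\diamond(Y^{-\mathsf T}\mathbf{b})\big)\,Y^{-1}\,\mathrm{diag}\big(\boldsymbol{\alpha}\diamond(Y^{-1}\mathbf{c})\big).$$ Moreover, for $\mathbf{y}\in\Omega$ (with $Y$ nonsingular), $\mathbf{H}(\mathbf{y})$ is an entrywise nonnegative matrix and $$0\preceq\mathbf{H}(\mathbf{y})\preceq L_f I,\qquad L_f:=\rho(\mathbf{H}(\mathbf{0})).$$ Furthermore, $L_f\le N\max_{i,j}[\mathbf{H}(\mathbf{0})]_{ij}$.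
   Context: Setting: $\mathcal{G}=(\mathcal{V},\mathcal{E})$ is a strongly connected directed graph on $\mathcal{V}=\{1,\dots,N\}$; $W=[w_{ij}]\in\mathbb{R}^{N\times N}$ is a nonnegative matrix such that for $i\ne j$, $w_{ij}>0$ if $(i,j)\in\mathcal{E}$ and $w_{ij}=0$ otherwise, and $w_{ii}>0$ for some $i$. $L:=\mathrm{diag}(W\mathbf{1})-W$ is the (weighted, possibly nonsymmetric) Laplacian, and $L_\beta:=L+\mathrm{diag}(\boldsymbol{\beta})$. $\mathbf{1}$ is the all-ones vector, $\mathrm{diag}(\mathbf{x})$ is the diagonal matrix with diagonal $\mathbf{x}$, $\diamond$ is the entrywise (Hadamard) product, $\rho$ is the spectral radius, $I$ the identity, and $\preceq$ the positive semidefinite (Loewner) order on symmetric matrices. Conventions: if $Y$ is singular (which happens exactly when $\boldsymbol{\beta}=\mathbf{0}$ and $\mathbf{y}\diamond\boldsymbol{\alpha}=\mathbf{0}$), then $f(\mathbf{y})=+\infty$. If $\boldsymbol{\beta}=\mathbf{0}$, then $L_\beta=L$ is singular and one sets $L_f=\infty$, so that the two statements involving $L_f$ carry content only for $\boldsymbol{\beta}\neq\mathbf{0}$. "Decreasing" means: $\mathbf{y}\le\mathbf{y}'$ entrywise implies $f(\mathbf{y})\ge f(\mathbf{y}')$. *)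

theory Defs
  imports
    "HOL-Analysis.Analysis"
    "Graph_Theory.Digraph_Component"
begin

text \<open>
  On vectors \<^typ>\<open>real^'n\<close> the library's \<open>*\<close>, \<open>\<le>\<close>, \<open>0\<close> and \<open>1\<close> are componentwise: \<open>x * y\<close> is the
  Hadamard product, \<open>1\<close> is the all-ones vector and \<open>{0..1}\<close> is the unit cube. Accordingly \<open>0 \<le> A\<close>
  for a matrix \<open>A\<close> means entrywise nonnegativity, while the matrix product is \<open>**\<close>.
\<close>

definition diag :: "real^'n \<Rightarrow> real^'n^'n" where
  "diag x = (\<chi> i j. if i = j then x $ i else 0)"

definition laplacian :: "real^'n^'n \<Rightarrow> real^'n^'n" where
  "laplacian W = diag (W *v 1) - W"

definition laplacian_loop :: "real^'n^'n \<Rightarrow> real^'n \<Rightarrow> real^'n^'n" where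
  "laplacian_loop W \<beta> = laplacian W + diag \<beta>"

definition Ymat :: "real^'n^'n \<Rightarrow> real^'n \<Rightarrow> real^'n \<Rightarrow> real^'n \<Rightarrow> real^'n^'n" where
  "Ymat W \<beta> \<alpha> y = laplacian_loop W \<beta> + diag (y * \<alpha>)"

definition objective ::
  "real^'n^'n \<Rightarrow> real^'n \<Rightarrow> real^'n \<Rightarrow> real^'n \<Rightarrow> real^'n \<Rightarrow> real^'n \<Rightarrow> ereal" where
  "objective W \<beta> \<alpha> b c y =
     (if invertible (Ymat W \<beta> \<alpha> y) then ereal (b \<bullet> (matrix_inv (Ymat W \<beta> \<alpha> y) *v c)) else \<infinity>)"

definition grad_formula ::
  "real^'n^'n \<Rightarrow> real^'n \<Rightarrow> real^'n \<Rightarrow> real^'n \<Rightarrow> real^'n \<Rightarrow> real^'n \<Rightarrow> real^'n" where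
  "grad_formula W \<beta> \<alpha> b c y =
     - ((transpose (matrix_inv (Ymat W \<beta> \<alpha> y)) *v b) * \<alpha> * (matrix_inv (Ymat W \<beta> \<alpha> y) *v c))"

definition half_hess ::
  "real^'n^'n \<Rightarrow> real^'n \<Rightarrow> real^'n \<Rightarrow> real^'n \<Rightarrow> real^'n \<Rightarrow> real^'n \<Rightarrow> real^'n^'n" where
  "half_hess W \<beta> \<alpha> b c y =
     diag (\<alpha> * (transpose (matrix_inv (Ymat W \<beta> \<alpha> y)) *v b))
     ** matrix_inv (Ymat W \<beta> \<alpha> y)
     ** diag (\<alpha> * (matrix_inv (Ymat W \<beta> \<alpha> y) *v c))"

text \<open>As a formula in \<open>y\<close>, this makes sense wherever \<^term>\<open>Ymat W \<beta> \<alpha> y\<close> is nonsingular,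
  in particular on the boundary of the cube.\<close>

definition hess_formula ::
  "real^'n^'n \<Rightarrow> real^'n \<Rightarrow> real^'n \<Rightarrow> real^'n \<Rightarrow> real^'n \<Rightarrow> real^'n \<Rightarrow> real^'n^'n" where
  "hess_formula W \<beta> \<alpha> b c y =
     half_hess W \<beta> \<alpha> b c y + transpose (half_hess W \<beta> \<alpha> b c y)"

definition complex_spectrum :: "real^'n^'n \<Rightarrow> complex set" where
  "complex_spectrum A = {k. \<exists>v. v \<noteq> 0 \<and> map_matrix complex_of_real A *v v = k *s v}"

definition spectral_radius :: "real^'n^'n \<Rightarrow> real" where
  "spectral_radius A = Max (cmod ` complex_spectrum A)"

definition loewner_le :: "real^'n^'n \<Rightarrow> real^'n^'n \<Rightarrow> bool" where
  "loewner_le A B \<longleftrightarrow> transpose A = A \<and> transpose B = B \<and> (\<forall>x. 0 \<le> x \<bullet> ((B - A) *v x))"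

text \<open>Convexity for extended-real-valued functions. For \<open>u = 0\<close> the convention \<open>0 * \<infinity> = 0\<close>
  of \<^typ>\<open>ereal\<close> makes the inequality trivial, as it should be.\<close>

definition ereal_convex_on :: "'a::real_vector set \<Rightarrow> ('a \<Rightarrow> ereal) \<Rightarrow> bool" where
  "ereal_convex_on S f \<longleftrightarrow> convex S \<and>
     (\<forall>x\<in>S. \<forall>y\<in>S. \<forall>u\<ge>0. \<forall>v\<ge>0. u + v = 1 \<longrightarrow>
        f (u *\<^sub>R x + v *\<^sub>R y) \<le> ereal u * f x + ereal v * f y)"

text \<open>\<open>Ck_on k S f\<close>, for open \<open>S\<close> in Euclidean space: \<open>f\<close> is \<open>k\<close> times continuously
  differentiable on \<open>S\<close>.\<close>

primrec Ck_on ::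
  "nat \<Rightarrow> 'a::real_normed_vector set \<Rightarrow> ('a \<Rightarrow> 'b::real_normed_vector) \<Rightarrow> bool" where
  "Ck_on 0 S f \<longleftrightarrow> continuous_on S f"
| "Ck_on (Suc k) S f \<longleftrightarrow> (\<forall>x\<in>S. f differentiable (at x)) \<and>
     (\<forall>v. Ck_on k S (\<lambda>x. frechet_derivative f (at x) v))"

definition smooth_on :: "'a::real_normed_vector set \<Rightarrow> ('a \<Rightarrow> 'b::real_normed_vector) \<Rightarrow> bool" where
  "smooth_on S f \<longleftrightarrow> (\<forall>k. Ck_on k S f)"

text \<open>The Hessian as the Jacobian matrix of the gradient.\<close>

definition has_hessian :: "(real^'n \<Rightarrow> real) \<Rightarrow> real^'n^'n \<Rightarrow> real^'n \<Rightarrow> bool" where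
  "has_hessian f A x \<longleftrightarrow>
     (\<exists>g. (\<forall>\<^sub>F z in nhds x. GDERIV f z :> g z) \<and> (g has_derivative (*v) A) (at x))"

end

theory Submission
  imports Defs
begin

text \<open>
  A minimum principle for \<open>Y = L + diag (\<beta> + y * \<alpha>)\<close> on the strongly connected graph shows that \<open>Y\<close>
  is nonsingular iff \<open>\<beta> + y * \<alpha> \<noteq> 0\<close>, that \<open>Y\<^sup>-\<^sup>1\<close> is then entrywise positive, and, by the resolvent
  identity, that \<open>Y\<^sup>-\<^sup>1\<close> decreases entrywise in \<open>y\<close>. With \<open>p = Y\<^sup>-\<^sup>T b\<close> and \<open>q = Y\<^sup>-\<^sup>1 c\<close>, the matrix
  \<open>diag p Y diag q\<close> has nonpositive off-diagonal entries and nonnegative row and column sums, so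
  its quadratic form is nonnegative; by congruence so is that of \<open>diag p Y\<^sup>-\<^sup>1 diag q\<close>, which makes the
  Hessian positive semidefinite and \<open>f\<close> convex along segments. Since \<open>0 \<le> H y \<le> H 0\<close> entrywise,
  passing to absolute values bounds the Rayleigh quotients of \<open>H y\<close> by those of \<open>H 0\<close>.
\<close>

subsection \<open>Matrix inversion as a differentiable map\<close>

lemma invertible_matrix_inv:
  fixes A :: "'a::semiring_1^'n^'m"
  assumes "invertible A"
  shows "A ** matrix_inv A = mat 1" "matrix_inv A ** A = mat 1"
  using someI_ex[OF assms[unfolded invertible_def]] by (simp_all add: matrix_inv_def)

lemma matrix_inv_mult_vec_cancel:
  fixes A :: "real^'n^'n"
  assumes "invertible A"
  shows "A *v (matrix_inv A *v x) = x" "matrix_inv A *v (A *v x) = x"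
  by (simp_all add: matrix_vector_mul_assoc invertible_matrix_inv[OF assms])

text \<open>Cramer's rule for the right-hand side \<open>axis j 1\<close>. It writes the entries of
  the inverse as quotients of polynomials in the entries, which yields continuity.\<close>

lemma matrix_inv_nth:
  fixes A :: "real^'n^'n"
  assumes "invertible A"
  shows "matrix_inv A $ k $ j = det (\<chi> i l. if l = k then axis j 1 $ i else A $ i $ l) / det A"
proof -
  have "A *v (matrix_inv A *v axis j 1) = axis j 1"
    by (rule matrix_inv_mult_vec_cancel[OF assms])
  then have "matrix_inv A *v axis j 1 =
      (\<chi> k. det (\<chi> i l. if l = k then axis j 1 $ i else A $ i $ l) / det A)"
    using cramer[of A] assms by (simp add: invertible_det_nz)
  then have "(matrix_inv A *v axis j 1) $ k =
      det (\<chi> i l. if l = k then axis j 1 $ i else A $ i $ l) / det A"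
    by simp
  then show ?thesis
    by (simp add: matrix_vector_mult_basis column_def)
qed

lemma continuous_on_det [continuous_intros]:
  fixes f :: "'a::topological_space \<Rightarrow> real^'n^'n"
  assumes "\<And>i j. continuous_on S (\<lambda>x. f x $ i $ j)"
  shows "continuous_on S (\<lambda>x. det (f x))"
  unfolding det_def by (intro continuous_intros assms)

lemma open_invertible: "open {A :: real^'n^'n. invertible A}"
proof -
  have "continuous_on UNIV (det :: real^'n^'n \<Rightarrow> real)"
    by (intro continuous_intros)
  then have "open (det -` (- {0}) :: (real^'n^'n) set)"
    by (intro open_vimage) auto
  then show ?thesis
    by (simp add: invertible_det_nz vimage_def)
qed

lemma continuous_on_matrix_inv:
  "continuous_on {A :: real^'n^'n. invertible A} matrix_inv"
proof -
  have "continuous_on {A :: real^'n^'n. invertible A} (\<lambda>A. matrix_inv A $ k $ j)" for k j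
  proof -
    have "continuous_on {A :: real^'n^'n. invertible A}
        (\<lambda>A. det (\<chi> i l. if l = k then axis j 1 $ i else A $ i $ l) / det A)"
    proof (intro continuous_on_divide continuous_on_det)
      show "continuous_on {A :: real^'n^'n. invertible A}
          (\<lambda>A. (\<chi> i l. if l = k then axis j 1 $ i else A $ i $ l) $ r $ s)" for r s
        by (cases "s = k") (simp_all, intro continuous_intros)
    qed (auto simp: invertible_det_nz intro!: continuous_intros)
    then show ?thesis
      by (rule continuous_on_eq) (simp add: matrix_inv_nth)
  qed
  then have "continuous_on {A :: real^'n^'n. invertible A} (\<lambda>A. \<chi> k j. matrix_inv A $ k $ j)"
    by (intro continuous_on_vec_lambda)
  then show ?thesis
    by simp
qed

section \<open>Bilinear products and the derivative of the inverse\<close>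

lemma matrix_add_rdistrib:
  fixes A B :: "'a::semiring_1^'n^'m"
  shows "(A + B) ** C = A ** C + B ** C"
  by (vector matrix_matrix_mult_def sum.distrib distrib_right)

lemma bounded_bilinear_matrix_matrix_mult:
  "bounded_bilinear ((**) :: real^'n^'m \<Rightarrow> real^'p^'n \<Rightarrow> real^'p^'m)"
  unfolding bilinear_conv_bounded_bilinear[symmetric] bilinear_def
  by (auto intro!: linearI simp: matrix_add_ldistrib matrix_add_rdistrib scalar_matrix_assoc matrix_scalar_ac)

lemma bounded_bilinear_matrix_vector_mult:
  "bounded_bilinear ((*v) :: real^'n^'m \<Rightarrow> real^'n \<Rightarrow> real^'m)"
  unfolding bilinear_conv_bounded_bilinear[symmetric] bilinear_def
  by (auto intro!: linearI simp: matrix_vector_right_distrib matrix_vector_mult_add_rdistrib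
      scaleR_matrix_vector_assoc matrix_scaleR_vector_ac)

text \<open>The factor \<open>f (y - x)\<close> is already of first order, so replacing
  \<open>g y\<close> by \<open>g x\<close> costs an error of smaller order. Continuity of
  \<open>g\<close> thus gives a derivative.\<close>

lemma (in bounded_bilinear) has_derivative_vanishing_factor:
  assumes f: "bounded_linear f" and g: "isCont g x"
  shows "((\<lambda>y. prod (f (y - x)) (g y)) has_derivative (\<lambda>h. prod (f h) (g x))) (at x)"
proof -
  obtain K where K: "\<And>a b. norm (prod a b) \<le> norm a * norm b * K" and K0: "0 \<le> K"
    using nonneg_bounded by blast
  obtain C where C: "\<And>h. norm (f h) \<le> norm h * C"
    using bounded_linear.bounded[OF f] by blast
  show ?thesis
  proof (rule has_derivativeI_sandwich[of 1])
    show "bounded_linear (\<lambda>h. prod (f h) (g x))"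
      by (rule bounded_linear_compose[OF bounded_linear_left f])
    show "norm (prod (f (y - x)) (g y) - prod (f (x - x)) (g x) - prod (f (y - x)) (g x))
        / norm (y - x) \<le> C * norm (g y - g x) * K" if "y \<noteq> x" for y
    proof -
      have "prod (f (y - x)) (g y) - prod (f (x - x)) (g x) - prod (f (y - x)) (g x)
          = prod (f (y - x)) (g y - g x)"
        by (simp add: diff_right linear_0[OF bounded_linear.linear[OF f]] zero_left)
      also have "norm \<dots> \<le> norm (f (y - x)) * norm (g y - g x) * K"
        by (rule K)
      also have "\<dots> \<le> (norm (y - x) * C) * norm (g y - g x) * K"
        by (intro mult_right_mono C K0) auto
      finally show ?thesis
        using that by (simp add: field_simps)
    qed
    have "((\<lambda>y. g y - g x) \<longlongrightarrow> 0) (at x)"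
      using g by (simp add: isCont_def LIM_zero)
    then have "((\<lambda>y. C * norm (g y - g x) * K) \<longlongrightarrow> C * 0 * K) (at x)"
      by (intro tendsto_intros) (simp add: tendsto_norm_zero)
    then show "((\<lambda>y. C * norm (g y - g x) * K) \<longlongrightarrow> 0) (at x)"
      by simp
  qed simp
qed

text \<open>By the resolvent identity, \<open>matrix_inv B\<close> is a constant minus
  \<open>matrix_inv A ** (B - A) ** matrix_inv B\<close>, where the factor before the last inverse
  vanishes linearly at \<open>B = A\<close>.\<close>

lemma has_derivative_matrix_inv:
  fixes A :: "real^'n^'n"
  assumes A: "invertible A"
  shows "(matrix_inv has_derivative (\<lambda>H. - (matrix_inv A ** H ** matrix_inv A))) (at A)"
proof -
  interpret M: bounded_bilinear "(**) :: real^'n^'n \<Rightarrow> real^'n^'n \<Rightarrow> real^'n^'n"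
    by (rule bounded_bilinear_matrix_matrix_mult)
  have cont: "isCont matrix_inv A"
    by (rule continuous_on_interior[OF continuous_on_matrix_inv])
      (simp add: interior_open open_invertible A)
  have "((\<lambda>B. matrix_inv A ** (B - A) ** matrix_inv B) has_derivative
      (\<lambda>H. matrix_inv A ** H ** matrix_inv A)) (at A)"
    by (rule M.has_derivative_vanishing_factor[OF M.bounded_linear_right cont])
  then have "((\<lambda>B. matrix_inv A - matrix_inv A ** (B - A) ** matrix_inv B) has_derivative
      (\<lambda>H. 0 - matrix_inv A ** H ** matrix_inv A)) (at A)"
    by (intro has_derivative_diff has_derivative_const)
  then have "((\<lambda>B. matrix_inv A - matrix_inv A ** (B - A) ** matrix_inv B) has_derivative
      (\<lambda>H. - (matrix_inv A ** H ** matrix_inv A))) (at A)"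
    by simp
  then show ?thesis
  proof (rule has_derivative_transform_within_open[OF _ open_invertible])
    fix B :: "real^'n^'n"
    assume "B \<in> {B. invertible B}"
    then have B: "B ** matrix_inv B = mat 1"
      by (simp add: invertible_matrix_inv)
    have "matrix_inv A ** (B - A) ** matrix_inv B
        = matrix_inv A ** (B ** matrix_inv B) - (matrix_inv A ** A) ** matrix_inv B"
      by (simp only: M.diff_left M.diff_right matrix_mul_assoc)
    then show "matrix_inv A - matrix_inv A ** (B - A) ** matrix_inv B = matrix_inv B"
      by (simp add: B invertible_matrix_inv[OF A])
  qed (use A in simp)
qed

subsection \<open>Functions of class \<open>C\<^sup>k\<close>\<close>

lemma Ck_on_cong:
  assumes "open S" "\<And>x. x \<in> S \<Longrightarrow> f x = g x"
  shows "Ck_on k S f \<longleftrightarrow> Ck_on k S g"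
  using assms(2)
proof (induction k arbitrary: f g)
  case 0
  then show ?case by (simp cong: continuous_on_cong)
next
  case (Suc k)
  have diff: "f differentiable (at x) \<longleftrightarrow> g differentiable (at x)" if "x \<in> S" for x
    using that Suc.prems assms(1) has_derivative_transform_within_open[of f _ x UNIV S g]
      has_derivative_transform_within_open[of g _ x UNIV S f]
    unfolding differentiable_def by auto
  have "Ck_on k S (\<lambda>x. frechet_derivative f (at x) v) \<longleftrightarrow>
      Ck_on k S (\<lambda>x. frechet_derivative g (at x) v)"
    if "\<forall>x\<in>S. f differentiable (at x)" for v
  proof (rule Suc.IH)
    fix x
    assume "x \<in> S"
    then show "frechet_derivative f (at x) v = frechet_derivative g (at x) v"
      using frechet_derivative_transform_within_open[OF _ assms(1), of f x g] that Suc.prems by simp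
  qed
  then show ?case
    using diff by auto
qed

text \<open>Lets a concrete derivative stand in for \<open>frechet_derivative\<close>, with which it
  agrees by uniqueness.\<close>

lemma Ck_on_SucI:
  assumes "open S" "\<And>x. x \<in> S \<Longrightarrow> (f has_derivative f' x) (at x)"
    and "\<And>v. Ck_on k S (\<lambda>x. f' x v)"
  shows "Ck_on (Suc k) S f"
proof -
  have "Ck_on k S (\<lambda>x. frechet_derivative f (at x) v)" for v
    using assms(3)[of v] Ck_on_cong[OF assms(1), of "\<lambda>x. f' x v" "\<lambda>x. frechet_derivative f (at x) v"]
    by (simp add: frechet_derivative_at[OF assms(2), symmetric])
  then show ?thesis
    using assms(2) by (auto simp: differentiable_def)
qed

lemma Ck_on_Suc_imp_Ck_on:
  assumes "open S" "Ck_on (Suc k) S f"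
  shows "Ck_on k S f"
  using assms(2)
proof (induction k arbitrary: f)
  case 0
  then show ?case
    by (auto intro!: continuous_at_imp_continuous_on differentiable_imp_continuous_within)
next
  case (Suc k)
  then show ?case by simp
qed

lemma Ck_on_const:
  assumes "open S"
  shows "Ck_on k S (\<lambda>x. c)"
proof (induction k arbitrary: c)
  case (Suc k)
  show ?case
    by (rule Ck_on_SucI[OF assms has_derivative_const Suc.IH])
qed simp

lemma Ck_on_add:
  assumes S: "open S" and "Ck_on k S f" "Ck_on k S g"
  shows "Ck_on k S (\<lambda>x. f x + g x)"
  using assms(2,3)
proof (induction k arbitrary: f g)
  case 0
  then show ?case by (simp add: continuous_on_add)
next
  case (Suc k)
  show ?case
  proof (rule Ck_on_SucI[OF S])
    show "((\<lambda>x. f x + g x) has_derivative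
        (\<lambda>v. frechet_derivative f (at x) v + frechet_derivative g (at x) v)) (at x)" if "x \<in> S" for x
      using Suc.prems that by (intro has_derivative_add) (simp_all flip: frechet_derivative_works)
    show "Ck_on k S (\<lambda>x. frechet_derivative f (at x) v + frechet_derivative g (at x) v)" for v
      using Suc.prems by (intro Suc.IH) simp_all
  qed
qed

lemma (in bounded_linear) Ck_on:
  assumes S: "open S" and "Ck_on k S g"
  shows "Ck_on k S (\<lambda>x. f (g x))"
  using assms(2)
proof (induction k arbitrary: g)
  case 0
  then show ?case by (simp add: continuous_on)
next
  case (Suc k)
  show ?case
  proof (rule Ck_on_SucI[OF S])
    show "((\<lambda>x. f (g x)) has_derivative (\<lambda>v. f (frechet_derivative g (at x) v))) (at x)"
      if "x \<in> S" for x
      using Suc.prems that by (intro has_derivative) (simp flip: frechet_derivative_works)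
    show "Ck_on k S (\<lambda>x. f (frechet_derivative g (at x) v))" for v
      using Suc.prems by (intro Suc.IH) simp
  qed
qed

lemma (in bounded_bilinear) Ck_on:
  assumes S: "open S" and "Ck_on k S f" "Ck_on k S g"
  shows "Ck_on k S (\<lambda>x. prod (f x) (g x))"
  using assms(2,3)
proof (induction k arbitrary: f g)
  case 0
  then show ?case by (simp add: continuous_on)
next
  case (Suc k)
  show ?case
  proof (rule Ck_on_SucI[OF S])
    show "((\<lambda>x. prod (f x) (g x)) has_derivative
        (\<lambda>v. prod (f x) (frechet_derivative g (at x) v) + prod (frechet_derivative f (at x) v) (g x)))
        (at x)" if "x \<in> S" for x
      using Suc.prems that by (intro FDERIV) (simp_all flip: frechet_derivative_works)
    show "Ck_on k S
        (\<lambda>x. prod (f x) (frechet_derivative g (at x) v) + prod (frechet_derivative f (at x) v) (g x))"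
      for v
      \<comment> \<open>In each summand one factor stays undifferentiated; it is of class k + 1 and
        is first lowered to class k.\<close>
      using Suc.prems Suc.prems[THEN Ck_on_Suc_imp_Ck_on[OF S]]
      by (intro Ck_on_add[OF S] Suc.IH) simp_all
  qed
qed

subsection \<open>Symmetric and diagonally dominant matrices\<close>

text \<open>By 2ab = a^2 + b^2 - (a - b)^2, twice the form splits into squares weighted by row sums,
  squares weighted by column sums, and minus squared differences weighted by entries; the
  differences vanish on the diagonal.\<close>

lemma quadratic_form_dominant_nonneg:
  fixes M :: "real^'n^'n"
  assumes off: "\<And>i j. i \<noteq> j \<Longrightarrow> M $ i $ j \<le> 0"
    and row: "\<And>i. 0 \<le> (\<Sum>j\<in>UNIV. M $ i $ j)"
    and col: "\<And>j. 0 \<le> (\<Sum>i\<in>UNIV. M $ i $ j)"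
  shows "0 \<le> x \<bullet> (M *v x)"
proof -
  have "2 * (x \<bullet> (M *v x)) = (\<Sum>i\<in>UNIV. \<Sum>j\<in>UNIV. M $ i $ j * (2 * x $ i * x $ j))"
    by (simp add: inner_vec_def matrix_vector_mult_def sum_distrib_left mult_ac)
  also have "\<dots> = (\<Sum>i\<in>UNIV. \<Sum>j\<in>UNIV. M $ i $ j * (x $ i)\<^sup>2 + M $ i $ j * (x $ j)\<^sup>2
      - M $ i $ j * (x $ i - x $ j)\<^sup>2)"
    by (intro sum.cong refl) (simp add: power2_eq_square algebra_simps)
  also have "\<dots> = (\<Sum>i\<in>UNIV. \<Sum>j\<in>UNIV. M $ i $ j * (x $ i)\<^sup>2)
      + (\<Sum>i\<in>UNIV. \<Sum>j\<in>UNIV. M $ i $ j * (x $ j)\<^sup>2)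
      - (\<Sum>i\<in>UNIV. \<Sum>j\<in>UNIV. M $ i $ j * (x $ i - x $ j)\<^sup>2)"
    by (simp only: sum.distrib sum_subtractf)
  also have "(\<Sum>i\<in>UNIV. \<Sum>j\<in>UNIV. M $ i $ j * (x $ j)\<^sup>2)
      = (\<Sum>j\<in>UNIV. \<Sum>i\<in>UNIV. M $ i $ j * (x $ j)\<^sup>2)"
    by (rule sum.swap)
  finally have eq: "2 * (x \<bullet> (M *v x)) = (\<Sum>i\<in>UNIV. (\<Sum>j\<in>UNIV. M $ i $ j) * (x $ i)\<^sup>2)
      + (\<Sum>j\<in>UNIV. (\<Sum>i\<in>UNIV. M $ i $ j) * (x $ j)\<^sup>2)
      - (\<Sum>i\<in>UNIV. \<Sum>j\<in>UNIV. M $ i $ j * (x $ i - x $ j)\<^sup>2)"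
    by (simp only: sum_distrib_right)
  have "M $ i $ j * (x $ i - x $ j)\<^sup>2 \<le> 0" for i j
    by (cases "i = j") (simp_all add: off mult_nonpos_nonneg)
  then have "(\<Sum>i\<in>UNIV. \<Sum>j\<in>UNIV. M $ i $ j * (x $ i - x $ j)\<^sup>2) \<le> 0"
    by (intro sum_nonpos)
  moreover have "0 \<le> (\<Sum>i\<in>UNIV. (\<Sum>j\<in>UNIV. M $ i $ j) * (x $ i)\<^sup>2)"
    by (intro sum_nonneg mult_nonneg_nonneg row) simp
  moreover have "0 \<le> (\<Sum>j\<in>UNIV. (\<Sum>i\<in>UNIV. M $ i $ j) * (x $ j)\<^sup>2)"
    by (intro sum_nonneg mult_nonneg_nonneg col) simp
  ultimately show ?thesis
    using eq by linarith
qed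

text \<open>Moving from \<open>v\<close> by \<open>t\<close> times \<open>B *v v\<close> makes the
  form a quadratic in \<open>t\<close> without constant term. Being nonnegative for all
  \<open>t\<close>, it has zero linear coefficient, which is twice the squared norm of
  \<open>B *v v\<close>.\<close>

lemma psd_zero_quadratic_form:
  fixes B :: "real^'n^'n"
  assumes sym: "transpose B = B" and psd: "\<And>x. 0 \<le> x \<bullet> (B *v x)" and v: "v \<bullet> (B *v v) = 0"
  shows "B *v v = 0"
proof -
  define u where "u = B *v v"
  have swap: "v \<bullet> (B *v u) = u \<bullet> u"
    by (metis dot_lmul_matrix sym transpose_matrix_vector u_def)
  have ineq: "0 \<le> 2 * t * (u \<bullet> u) + t\<^sup>2 * (u \<bullet> (B *v u))" for t :: real
  proof -
    have "(v + t *\<^sub>R u) \<bullet> (B *v (v + t *\<^sub>R u))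
        = v \<bullet> (B *v v) + t * (v \<bullet> (B *v u)) + t * (u \<bullet> (B *v v)) + t\<^sup>2 * (u \<bullet> (B *v u))"
      by (simp add: matrix_vector_right_distrib matrix_vector_mult_scaleR inner_simps
          power2_eq_square algebra_simps)
    then show ?thesis
      using psd[of "v + t *\<^sub>R u"] v swap by (simp add: u_def)
  qed
  define K where "K = u \<bullet> (B *v u)"
  have K: "0 \<le> K"
    using psd by (simp add: K_def)
  have "u = 0"
  proof (rule ccontr)
    assume "u \<noteq> 0"
    then have pos: "0 < u \<bullet> u"
      by simp
    \<comment> \<open>This negative \<open>t\<close> keeps \<open>t * K\<close> at least
      \<open>- (u \<bullet> u)\<close>, so the linear term prevails; the \<open>+ 1\<close> covers
      \<open>K = 0\<close>.\<close>
    define t where "t = - (u \<bullet> u) / (K + 1)"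
    have expand: "2 * t * (u \<bullet> u) + t\<^sup>2 * K = t * (2 * (u \<bullet> u) + t * K)"
      by (simp add: power2_eq_square algebra_simps)
    have "t < 0"
      using pos K unfolding t_def by (intro divide_neg_pos) auto
    moreover have "t * K = - ((u \<bullet> u) * (K / (K + 1)))"
      by (simp add: t_def)
    moreover have "(u \<bullet> u) * (K / (K + 1)) \<le> (u \<bullet> u) * 1"
      using pos K by (intro mult_left_mono) auto
    ultimately have "t < 0 \<and> 0 < 2 * (u \<bullet> u) + t * K"
      using pos by linarith
    then have "2 * t * (u \<bullet> u) + t\<^sup>2 * K < 0"
      by (simp add: expand mult_less_0_iff)
    then show False
      using ineq[of t] by (simp add: K_def)
  qed
  then show ?thesis
    by (simp add: u_def)
qed

text \<open>The form attains its maximum \<open>k\<close> on the compact unit sphere. Then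
  \<open>k *\<^sub>R mat 1 - A\<close> is positive semidefinite with vanishing form at the
  maximiser, which therefore lies in its kernel.\<close>

lemma symmetric_rayleigh_eigenvector:
  fixes A :: "real^'n^'n"
  assumes sym: "transpose A = A"
  obtains k v where "v \<noteq> 0" "A *v v = k *\<^sub>R v" "\<And>x. x \<bullet> (A *v x) \<le> k * (x \<bullet> x)"
proof -
  have "continuous_on (sphere (0 :: real^'n) 1) (\<lambda>x. x \<bullet> (A *v x))"
    by (intro continuous_intros linear_continuous_on_compose matrix_vector_mul_linear)
  then have "\<exists>v\<in>sphere 0 1. \<forall>x\<in>sphere 0 1. x \<bullet> (A *v x) \<le> v \<bullet> (A *v v)"
    by (intro continuous_attains_sup compact_sphere) auto
  then obtain v where v: "v \<in> sphere 0 1"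
    and max: "\<And>x. x \<in> sphere 0 1 \<Longrightarrow> x \<bullet> (A *v x) \<le> v \<bullet> (A *v v)"
    by blast
  define k where "k = v \<bullet> (A *v v)"
  define B where "B = k *\<^sub>R mat 1 - A"
  have vv: "v \<bullet> v = 1"
    using v by (simp add: norm_eq_1)
  have Bx: "B *v x = k *\<^sub>R x - A *v x" for x
    by (simp add: B_def matrix_vector_mult_diff_rdistrib flip: scaleR_matrix_vector_assoc)
  have le: "x \<bullet> (A *v x) \<le> k * (x \<bullet> x)" for x
  proof (cases "x = 0")
    case False
    then have "(x /\<^sub>R norm x) \<bullet> (A *v (x /\<^sub>R norm x)) \<le> k"
      unfolding k_def by (intro max) simp
    then have "(x \<bullet> (A *v x)) / (norm x)\<^sup>2 \<le> k"
      by (simp add: matrix_vector_mult_scaleR power2_eq_square divide_simps)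
    then show ?thesis
      using False by (simp add: divide_le_eq power2_norm_eq_inner)
  qed simp
  have "B *v v = 0"
  proof (rule psd_zero_quadratic_form)
    show "transpose B = B"
      using sym by (simp add: B_def transpose_def vec_eq_iff mat_def)
    show "0 \<le> x \<bullet> (B *v x)" for x
      using le by (simp add: Bx inner_diff_right)
    show "v \<bullet> (B *v v) = 0"
      by (simp add: Bx inner_diff_right vv k_def)
  qed
  then have "A *v v = k *\<^sub>R v"
    by (simp add: Bx)
  moreover have "v \<noteq> 0"
    using vv by auto
  ultimately show ?thesis
    using le that by blast
qed

text \<open>Eigenvectors for distinct eigenvalues are orthogonal, and a pairwise orthogonal set is
  finite. Finiteness makes the \<open>Max\<close> in \<open>spectral_radius\<close>
  meaningful.\<close>

lemma finite_eigenvalues_symmetric: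
  fixes A :: "real^'n^'n"
  assumes sym: "transpose A = A"
  shows "finite {k. \<exists>v. v \<noteq> 0 \<and> A *v v = k *\<^sub>R v}"
proof -
  define E where "E = {k. \<exists>v. v \<noteq> 0 \<and> A *v v = k *\<^sub>R v}"
  define v where "v k = (SOME v. v \<noteq> 0 \<and> A *v v = k *\<^sub>R v)" for k
  have v: "v k \<noteq> 0 \<and> A *v v k = k *\<^sub>R v k" if "k \<in> E" for k
    unfolding v_def by (rule someI_ex) (use that in \<open>simp add: E_def\<close>)
  have orth: "v k \<bullet> v l = 0" if "k \<in> E" "l \<in> E" "k \<noteq> l" for k l
  proof -
    have "(A *v v k) \<bullet> v l = v k \<bullet> (A *v v l)"
      by (metis dot_lmul_matrix sym transpose_matrix_vector)
    then have "(k - l) * (v k \<bullet> v l) = 0"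
      using v that by (simp add: algebra_simps)
    then show ?thesis
      using that by simp
  qed
  have "inj_on v E"
  proof (rule inj_onI)
    fix k l
    assume "k \<in> E" "l \<in> E" "v k = v l"
    \<comment> \<open>For distinct eigenvalues a shared eigenvector would be orthogonal to itself,
      hence zero.\<close>
    then show "k = l"
      using orth[of k l] v[of k] by auto
  qed
  moreover have "pairwise orthogonal (v ` E)"
    using orth by (auto simp: pairwise_def orthogonal_def)
  then have "finite (v ` E)"
    by (rule pairwise_orthogonal_imp_finite)
  ultimately show ?thesis
    unfolding E_def[symmetric] by (simp add: finite_image_iff)
qed

text \<open>An eigenvector is split into real part \<open>a\<close> and imaginary part
  \<open>b\<close>. Symmetry, as \<open>(A *v a) \<bullet> b = a \<bullet> (A *v b)\<close>, forces
  a real eigenvalue, and whichever of \<open>a\<close> and \<open>b\<close> is nonzero is then a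
  real eigenvector.\<close>

lemma complex_spectrum_symmetric:
  fixes A :: "real^'n^'n"
  assumes sym: "transpose A = A"
  shows "complex_spectrum A = of_real ` {k. \<exists>v. v \<noteq> 0 \<and> A *v v = k *\<^sub>R v}"
proof (intro set_eqI iffI)
  fix z :: complex
  assume "z \<in> of_real ` {k. \<exists>v. v \<noteq> 0 \<and> A *v v = k *\<^sub>R v}"
  then obtain k v where z: "z = of_real k" and v: "v \<noteq> 0" "A *v v = k *\<^sub>R v"
    by auto
  define u :: "complex^'n" where "u = (\<chi> i. of_real (v $ i))"
  have "u \<noteq> 0"
    using v(1) by (auto simp: u_def vec_eq_iff)
  moreover have "map_matrix complex_of_real A *v u = z *s u"
  proof (rule vec_eq_iff[THEN iffD2], rule allI)
    fix i
    have "(map_matrix complex_of_real A *v u) $ i = of_real ((A *v v) $ i)"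
      by (simp add: matrix_vector_mult_def map_matrix_def u_def)
    then show "(map_matrix complex_of_real A *v u) $ i = (z *s u) $ i"
      by (simp add: v(2) z u_def)
  qed
  ultimately show "z \<in> complex_spectrum A"
    unfolding complex_spectrum_def by blast
next
  fix z
  assume "z \<in> complex_spectrum A"
  then obtain u where u: "u \<noteq> 0" "map_matrix complex_of_real A *v u = z *s u"
    unfolding complex_spectrum_def by blast
  define a where "a = (\<chi> i. Re (u $ i))"
  define b where "b = (\<chi> i. Im (u $ i))"
  have ui: "(\<Sum>j\<in>UNIV. of_real (A $ i $ j) * u $ j) = z * u $ i" for i
    using u(2) by (simp add: vec_eq_iff matrix_vector_mult_def map_matrix_def)
  have a: "A *v a = Re z *\<^sub>R a - Im z *\<^sub>R b"
    using ui[THEN arg_cong[where f = Re]]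
    by (simp add: vec_eq_iff matrix_vector_mult_def a_def b_def)
  have b: "A *v b = Re z *\<^sub>R b + Im z *\<^sub>R a"
    using ui[THEN arg_cong[where f = Im]]
    by (simp add: vec_eq_iff matrix_vector_mult_def a_def b_def)
  have ab: "a \<noteq> 0 \<or> b \<noteq> 0"
    using u(1) by (auto simp: vec_eq_iff a_def b_def complex_eq_iff)
  have "(A *v a) \<bullet> b = a \<bullet> (A *v b)"
    by (metis dot_lmul_matrix sym transpose_matrix_vector)
  then have "Im z * (a \<bullet> a + b \<bullet> b) = 0"
    by (simp add: a b inner_simps algebra_simps inner_commute)
  moreover have "0 < a \<bullet> a + b \<bullet> b"
    using ab by (auto intro: add_nonneg_pos add_pos_nonneg)
  ultimately have im: "Im z = 0"
    by simp
  then have "z = of_real (Re z)"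
    by (simp add: complex_eq_iff)
  moreover have "\<exists>v. v \<noteq> 0 \<and> A *v v = Re z *\<^sub>R v"
    using ab a b im by auto
  ultimately show "z \<in> of_real ` {k. \<exists>v. v \<noteq> 0 \<and> A *v v = k *\<^sub>R v}"
    by blast
qed

text \<open>The maximal Rayleigh quotient is itself an eigenvalue, so the spectral radius bounds
  it.\<close>

lemma quadratic_form_le_spectral_radius:
  fixes A :: "real^'n^'n"
  assumes sym: "transpose A = A"
  shows "x \<bullet> (A *v x) \<le> spectral_radius A * (x \<bullet> x)"
proof -
  obtain k v where v: "v \<noteq> 0" "A *v v = k *\<^sub>R v" and k: "\<And>x. x \<bullet> (A *v x) \<le> k * (x \<bullet> x)"
    using symmetric_rayleigh_eigenvector[OF sym] by blast
  have "complex_of_real k \<in> complex_spectrum A"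
    using v by (auto simp: complex_spectrum_symmetric[OF sym])
  moreover have "finite (complex_spectrum A)"
    using finite_eigenvalues_symmetric[OF sym] by (simp add: complex_spectrum_symmetric[OF sym])
  ultimately have "cmod (complex_of_real k) \<le> spectral_radius A"
    unfolding spectral_radius_def by (intro Max_ge finite_imageI imageI)
  then have "k \<le> spectral_radius A"
    by simp
  then have "k * (x \<bullet> x) \<le> spectral_radius A * (x \<bullet> x)"
    by (intro mult_right_mono) auto
  then show ?thesis
    using k[of x] by linarith
qed

text \<open>As for Gershgorin discs, the eigenvalue equation is read at a coordinate where the
  eigenvector has largest modulus.\<close>

lemma spectral_radius_le_symmetric:
  fixes A :: "real^'n^'n"
  assumes sym: "transpose A = A" and le: "\<And>i j. \<bar>A $ i $ j\<bar> \<le> m"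
  shows "spectral_radius A \<le> real CARD('n) * m"
proof -
  \<comment> \<open>This eigenvalue shows that the spectrum is nonempty, as
    \<open>Max_le_iff\<close> requires.\<close>
  obtain k v where v: "v \<noteq> 0" "A *v v = k *\<^sub>R v" 
    using symmetric_rayleigh_eigenvector[OF sym] by blast
  have "complex_of_real k \<in> complex_spectrum A"
    using v by (auto simp: complex_spectrum_symmetric[OF sym])
  moreover have "finite (complex_spectrum A)"
    using finite_eigenvalues_symmetric[OF sym] by (simp add: complex_spectrum_symmetric[OF sym])
  moreover have "cmod z \<le> real CARD('n) * m" if spec: "z \<in> complex_spectrum A" for z
  proof -
    obtain k v where z: "z = of_real k" and v: "v \<noteq> 0" "A *v v = k *\<^sub>R v"
      using spec unfolding complex_spectrum_symmetric[OF sym] by auto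
    have "Max (range (\<lambda>i. \<bar>v $ i\<bar>)) \<in> range (\<lambda>i. \<bar>v $ i\<bar>)"
      by (intro Max_in) auto
    then obtain i where i: "Max (range (\<lambda>i. \<bar>v $ i\<bar>)) = \<bar>v $ i\<bar>"
      by (rule rangeE)
    have max: "\<bar>v $ j\<bar> \<le> \<bar>v $ i\<bar>" for j
      unfolding i[symmetric] by (intro Max_ge) auto
    have "v $ i \<noteq> 0"
    proof
      assume "v $ i = 0"
      then have "v = 0"
        using max by (simp add: vec_eq_iff)
      then show False
        using v(1) by contradiction
    qed
    moreover have "\<bar>k\<bar> * \<bar>v $ i\<bar> \<le> (real CARD('n) * m) * \<bar>v $ i\<bar>"
    proof -
      have "\<bar>k\<bar> * \<bar>v $ i\<bar> = \<bar>(A *v v) $ i\<bar>"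
        by (simp add: v(2) abs_mult)
      also have "\<dots> \<le> (\<Sum>j\<in>UNIV. \<bar>A $ i $ j * v $ j\<bar>)"
        by (simp add: matrix_vector_mult_def)
      also have "\<dots> \<le> (\<Sum>j\<in>(UNIV :: 'n set). m * \<bar>v $ i\<bar>)"
        unfolding abs_mult
        by (intro sum_mono mult_mono le max) (use le[of i i] in auto)
      finally show ?thesis
        by simp
    qed
    ultimately show ?thesis
      by (simp add: z)
  qed
  ultimately show ?thesis
    unfolding spectral_radius_def by (subst Max_le_iff) auto
qed

subsection \<open>Inverse positivity of the loopy Laplacian\<close>

lemma diag_mult_vec: "diag x *v y = x * y"
  by (simp add: diag_def matrix_vector_mult_def vec_eq_iff if_distrib[of "\<lambda>a. a * _"] cong: if_cong)

lemma vec_mult_diag: "x v* diag y = x * y"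
  by (simp add: diag_def vector_matrix_mult_def vec_eq_iff if_distrib[of "\<lambda>a. _ * a"] cong: if_cong)

lemma mult_diag_nth: "(A ** diag x) $ i $ j = A $ i $ j * x $ j"
  by (simp add: diag_def matrix_matrix_mult_def if_distrib[of "\<lambda>a. _ * a"] cong: if_cong)

lemma diag_mult_nth: "(diag x ** A) $ i $ j = x $ i * A $ i $ j"
  by (simp add: diag_def matrix_matrix_mult_def if_distrib[of "\<lambda>a. a * _"] cong: if_cong)

text \<open>The difference form suits the minimum principle: for nonnegative weights, all terms of
  the sum are nonpositive at a minimum of \<open>x\<close>.\<close>

lemma laplacian_loop_mult_vec_nth:
  "(laplacian_loop W d *v x) $ i = (\<Sum>j\<in>UNIV. W $ i $ j * (x $ i - x $ j)) + d $ i * x $ i"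
  by (simp add: laplacian_loop_def laplacian_def matrix_vector_mult_add_rdistrib
      matrix_vector_mult_diff_rdistrib diag_mult_vec)
    (simp add: matrix_vector_mult_def sum_subtractf sum_distrib_right right_diff_distrib)

lemma laplacian_loop_off_diag:
  "i \<noteq> j \<Longrightarrow> laplacian_loop W d $ i $ j = - W $ i $ j"
  by (simp add: laplacian_loop_def laplacian_def diag_def)

text \<open>The graph part cancels, so the middle factor of the resolvent identity is
  diagonal.\<close>

lemma laplacian_loop_diff: "laplacian_loop W d - laplacian_loop W e = diag (d - e)"
  by (simp add: laplacian_loop_def diag_def vec_eq_iff)

text \<open>Substituting \<open>q * x = Y (q * w)\<close> turns the form into \<open>w \<bullet> (diag p Y diag q) w\<close>, where
  \<open>diag p Y diag q\<close> has row sums \<open>p * c\<close> and column sums \<open>q * b\<close>.\<close>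

lemma quadratic_form_inverse_nonneg:
  fixes Y :: "real^'n^'n"
  assumes inv: "invertible Y" and off: "\<And>i j. i \<noteq> j \<Longrightarrow> Y $ i $ j \<le> 0"
    and bc: "0 \<le> b" "0 \<le> c"
    and p: "p = b v* matrix_inv Y" "0 \<le> p"
    and q: "q = matrix_inv Y *v c" "\<And>i. 0 < q $ i"
  shows "0 \<le> x \<bullet> (p * (matrix_inv Y *v (q * x)))"
proof -
  define w where "w = (\<chi> i. (matrix_inv Y *v (q * x)) $ i / q $ i)"
  have qw: "matrix_inv Y *v (q * x) = q * w"
    using q(2) by (simp add: w_def vec_eq_iff less_imp_neq[symmetric])
  then have Yqw: "Y *v (q * w) = q * x"
    by (metis inv matrix_inv_mult_vec_cancel(1))
  have Yq: "Y *v q = c"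
    by (simp add: q(1) inv matrix_inv_mult_vec_cancel)
  have pY: "p v* Y = b"
    by (simp add: p(1) inv invertible_matrix_inv vector_matrix_mul_assoc)
  define M where "M = (\<chi> i j. p $ i * Y $ i $ j * q $ j)"
  \<comment> \<open>The factor \<open>q\<close> moves from \<open>w\<close> to \<open>x\<close>,
    where \<open>q * x\<close> is \<open>Y *v (q * w)\<close>.\<close>
  have "x \<bullet> (p * (matrix_inv Y *v (q * x))) = w \<bullet> (p * (Y *v (q * w)))"
    unfolding qw Yqw by (simp add: inner_vec_def mult_ac)
  also have "p * (Y *v (q * w)) = M *v w"
    by (simp add: M_def vec_eq_iff matrix_vector_mult_def sum_distrib_left mult_ac)
  also have "0 \<le> w \<bullet> (M *v w)"
  proof (rule quadratic_form_dominant_nonneg)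
    show "M $ i $ j \<le> 0" if "i \<noteq> j" for i j
      using off[OF that] p(2) q(2)[of j]
      by (simp add: M_def less_eq_vec_def mult_nonneg_nonpos mult_nonpos_nonneg)
    show "0 \<le> (\<Sum>j\<in>UNIV. M $ i $ j)" for i
    proof -
      have "(\<Sum>j\<in>UNIV. M $ i $ j) = p $ i * (Y *v q) $ i"
        by (simp add: M_def matrix_vector_mult_def sum_distrib_left mult_ac)
      then show ?thesis
        using bc(2) p(2) by (simp add: Yq less_eq_vec_def)
    qed
    show "0 \<le> (\<Sum>i\<in>UNIV. M $ i $ j)" for j
    proof -
      have "(\<Sum>i\<in>UNIV. M $ i $ j) = (p v* Y) $ j * q $ j"
        by (simp add: M_def vector_matrix_mult_def sum_distrib_left sum_distrib_right mult_ac)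
      then show ?thesis
        using bc(1) q(2)[of j] by (simp add: pY less_eq_vec_def)
    qed
  qed
  finally show ?thesis .
qed

text \<open>Irreducibility in path form: strong connectivity is read off the positive entries of
  \<open>W\<close>, which keeps the digraph type out of the matrix arguments.\<close>

locale irreducible_weights =
  fixes W :: "real^'n^'n"
  assumes nonneg: "0 \<le> W $ i $ j"
    and connected: "(i, j) \<in> {(i, j). 0 < W $ i $ j}\<^sup>*"
begin

text \<open>Suppose the minimum is not positive. In the row of a minimising index every term is
  nonpositive while the total is nonnegative, so the differences weigh zero and out-neighbours
  attain the minimum too. Connectivity makes \<open>x\<close> constant, and a row with
  \<open>0 < d $ i\<close> forces the constant to be 0.\<close>

lemma minimum_principle:
  assumes d: "0 \<le> d" "d \<noteq> 0" and x: "0 \<le> laplacian_loop W d *v x"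
  shows "x = 0 \<or> (\<forall>i. 0 < x $ i)"
proof -
  have "Min (range (($) x)) \<in> range (($) x)"
    by (intro Min_in) auto
  then obtain m where "Min (range (($) x)) = x $ m"
    by (rule rangeE)
  moreover have "Min (range (($) x)) \<le> x $ i" for i
    by (intro Min_le) auto
  ultimately have min: "x $ m \<le> x $ i" for i
    by simp
  show ?thesis
  proof (cases "0 < x $ m")
    case True
    then show ?thesis
      using min by (meson less_le_trans)
  next
    case False
    have const: "x $ j = x $ m" for j
      using connected[of m j]
    proof (induction rule: rtrancl_induct)
      case (step j k)
      have terms: "W $ j $ l * (x $ j - x $ l) \<le> 0" for l
        using nonneg min step.IH by (simp add: mult_nonneg_nonpos)
      have "d $ j * x $ j \<le> 0"
        using d(1) False step.IH by (simp add: less_eq_vec_def mult_nonneg_nonpos)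
      moreover have "0 \<le> (\<Sum>l\<in>UNIV. W $ j $ l * (x $ j - x $ l)) + d $ j * x $ j"
        using x by (simp add: less_eq_vec_def laplacian_loop_mult_vec_nth)
      moreover have "(\<Sum>l\<in>UNIV. W $ j $ l * (x $ j - x $ l)) \<le> 0"
        by (intro sum_nonpos terms)
      ultimately have "(\<Sum>l\<in>UNIV. W $ j $ l * (x $ j - x $ l)) = 0"
        by linarith
      then have "W $ j $ k * (x $ j - x $ k) = 0"
        using sum_nonneg_eq_0_iff[of UNIV "\<lambda>l. - (W $ j $ l * (x $ j - x $ l))"] terms
        by (simp add: sum_negf)
      then show ?case
        using step by auto
    qed simp
    obtain i where i: "0 < d $ i"
      using d by (metis less_eq_vec_def order_le_less vec_eq_iff zero_index)
    have "(\<Sum>j\<in>UNIV. W $ i $ j * (x $ i - x $ j)) = 0"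
    proof (intro sum.neutral ballI)
      show "W $ i $ j * (x $ i - x $ j) = 0" for j
        using const[of i] const[of j] by simp
    qed
    then have "(laplacian_loop W d *v x) $ i = d $ i * x $ m"
      using const[of i] by (simp only: laplacian_loop_mult_vec_nth add_0)
    then have "0 \<le> d $ i * x $ m"
      using x by (metis less_eq_vec_def zero_index)
    then have "x $ m = 0"
      using i False by (simp add: zero_le_mult_iff)
    then have "x $ j = 0" for j
      using const[of j] by simp
    then show ?thesis
      by (simp add: vec_eq_iff)
  qed
qed

text \<open>Without loop weights the all-ones vector lies in the kernel. With them, the minimum
  principle applies to a kernel vector and to its negative, which cannot both be positive.\<close>

lemma invertible_laplacian_loop_iff:
  assumes "0 \<le> d"
  shows "invertible (laplacian_loop W d) \<longleftrightarrow> d \<noteq> 0"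
proof
  assume inv: "invertible (laplacian_loop W d)"
  show "d \<noteq> 0"
  proof
    assume "d = 0"
    then have "laplacian_loop W d *v 1 = 0"
      by (simp add: vec_eq_iff laplacian_loop_mult_vec_nth)
    then have "1 = (0 :: real^'n)"
      by (metis inv matrix_inv_mult_vec_cancel(2) matrix_vector_mult_0_right)
    then show False
      by simp
  qed
next
  assume "d \<noteq> 0"
  have "x = 0" if x: "laplacian_loop W d *v x = 0" for x
  proof (rule ccontr)
    assume "x \<noteq> 0"
    then have "0 < x $ i" "x $ i < 0" for i
      using minimum_principle[OF assms \<open>d \<noteq> 0\<close>, of x] minimum_principle[OF assms \<open>d \<noteq> 0\<close>, of "- x"] x
      by (simp_all add: linear_neg[OF matrix_vector_mul_linear])
    then show False
      using less_asym by blast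
  qed
  then show "invertible (laplacian_loop W d)"
    by (simp add: invertible_left_inverse matrix_left_invertible_ker)
qed

context
  fixes d :: "real^'n"
  assumes d: "0 \<le> d" "d \<noteq> 0"
begin

text \<open>The vector solves a system with right-hand side \<open>c\<close>, so the minimum
  principle applies; its zero alternative would give \<open>c = 0\<close>.\<close>

lemma inv_mult_vec_pos:
  assumes "0 \<le> c" "c \<noteq> 0"
  shows "0 < (matrix_inv (laplacian_loop W d) *v c) $ i"
proof -
  have "laplacian_loop W d *v (matrix_inv (laplacian_loop W d) *v c) = c"
    using d by (simp add: matrix_inv_mult_vec_cancel invertible_laplacian_loop_iff)
  then show ?thesis
    using minimum_principle[OF d, of "matrix_inv (laplacian_loop W d) *v c"] assms by auto
qed

lemma inv_pos: "0 < matrix_inv (laplacian_loop W d) $ i $ j"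
proof -
  have "0 \<le> axis j (1 :: real)"
    by (simp add: less_eq_vec_def axis_def)
  then show ?thesis
    using inv_mult_vec_pos[of "axis j 1" i] by (simp add: matrix_vector_mult_basis column_def)
qed

text \<open>A positive entry of \<open>b\<close> meets a strictly positive row of the inverse; the
  other terms are nonnegative.\<close>

lemma vec_mult_inv_pos:
  assumes "0 \<le> b" "b \<noteq> 0"
  shows "0 < (b v* matrix_inv (laplacian_loop W d)) $ j"
proof -
  obtain i where "0 < b $ i"
    using assms by (metis less_eq_vec_def order_le_less vec_eq_iff zero_index)
  then show ?thesis
    unfolding vector_matrix_mult_def using assms(1) inv_pos
    by (auto intro!: sum_pos2[of _ i] mult_nonneg_nonneg simp: less_eq_vec_def less_imp_le)
qed

end

text \<open>The resolvent identity writes the difference of the two inverses as one inverse times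
  \<open>diag (e - d)\<close> times the other, a product of entrywise nonnegative matrices.\<close>

lemma inv_antimono:
  assumes d: "0 \<le> d" "d \<noteq> 0" and e: "d \<le> e"
  shows "matrix_inv (laplacian_loop W e) $ i $ j \<le> matrix_inv (laplacian_loop W d) $ i $ j"
proof -
  let ?D = "laplacian_loop W d" and ?E = "laplacian_loop W e"
  interpret M: bounded_bilinear "(**) :: real^'n^'n \<Rightarrow> real^'n^'n \<Rightarrow> real^'n^'n"
    by (rule bounded_bilinear_matrix_matrix_mult)
  have e0: "0 \<le> e" "e \<noteq> 0"
    using d e by auto
  have inv: "invertible ?D" "invertible ?E"
    using d e0 by (simp_all add: invertible_laplacian_loop_iff)
  have "matrix_inv ?D ** diag (e - d) ** matrix_inv ?E
      = matrix_inv ?D ** (?E ** matrix_inv ?E) - (matrix_inv ?D ** ?D) ** matrix_inv ?E"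
    unfolding laplacian_loop_diff[of W, symmetric]
    by (simp only: M.diff_left M.diff_right matrix_mul_assoc)
  then have "matrix_inv ?D - matrix_inv ?E = matrix_inv ?D ** diag (e - d) ** matrix_inv ?E"
    by (simp add: inv invertible_matrix_inv)
  then have "matrix_inv ?D $ i $ j - matrix_inv ?E $ i $ j
      = (\<Sum>k\<in>UNIV. matrix_inv ?D $ i $ k * (e $ k - d $ k) * matrix_inv ?E $ k $ j)"
    by (simp add: vec_eq_iff matrix_matrix_mult_def[of "_ ** _"] mult_diag_nth)
  also have "\<dots> \<ge> 0"
    using e inv_pos[OF d] inv_pos[OF e0]
    by (intro sum_nonneg mult_nonneg_nonneg) (auto simp: less_eq_vec_def less_imp_le)
  finally show ?thesis
    by simp
qed

end

subsection \<open>Derivatives of the objective\<close>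

text \<open>The variable only adds loop weight, so results on \<open>laplacian_loop W d\<close>
  apply with \<open>d = \<beta> + y * \<alpha>\<close>.\<close>

lemma Ymat_eq_laplacian_loop: "Ymat W \<beta> \<alpha> y = laplacian_loop W (\<beta> + y * \<alpha>)"
  by (simp add: Ymat_def laplacian_loop_def diag_def vec_eq_iff)

lemma half_hess_nth:
  "half_hess W \<beta> \<alpha> b c y $ i $ j =
    (\<alpha> * (b v* matrix_inv (Ymat W \<beta> \<alpha> y))) $ i * matrix_inv (Ymat W \<beta> \<alpha> y) $ i $ j
      * (\<alpha> * (matrix_inv (Ymat W \<beta> \<alpha> y) *v c)) $ j"
  by (simp add: half_hess_def mult_diag_nth diag_mult_nth)

lemma hess_formula_nth:
  "hess_formula W \<beta> \<alpha> b c y $ i $ j = half_hess W \<beta> \<alpha> b c y $ i $ j + half_hess W \<beta> \<alpha> b c y $ j $ i"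
  by (simp add: hess_formula_def transpose_def)

lemma transpose_hess_formula: "transpose (hess_formula W \<beta> \<alpha> b c y) = hess_formula W \<beta> \<alpha> b c y"
  by (simp add: transpose_def vec_eq_iff hess_formula_nth add.commute)

text \<open>Both halves of the Hessian have the same form, and the outer factors \<alpha> are
  absorbed into \<open>x\<close>; this is the shape treated by
  \<open>quadratic_form_inverse_nonneg\<close>.\<close>

lemma hess_formula_quadratic_form:
  fixes x y \<alpha> \<beta> :: "real^'n" and W :: "real^'n^'n"
  defines "Z \<equiv> matrix_inv (Ymat W \<beta> \<alpha> y)"
  shows "x \<bullet> (hess_formula W \<beta> \<alpha> b c y *v x) =
    2 * ((\<alpha> * x) \<bullet> ((b v* Z) * (Z *v ((Z *v c) * (\<alpha> * x)))))"
proof -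
  let ?A = "half_hess W \<beta> \<alpha> b c y"
  have "x \<bullet> (transpose ?A *v x) = x \<bullet> (?A *v x)"
    by (metis dot_lmul_matrix inner_commute transpose_matrix_vector)
  then have "x \<bullet> (hess_formula W \<beta> \<alpha> b c y *v x) = 2 * (x \<bullet> (?A *v x))"
    by (simp add: hess_formula_def matrix_vector_mult_add_rdistrib inner_add_right del: transpose_matrix_vector)
  also have "?A *v x = \<alpha> * (b v* Z) * (Z *v (\<alpha> * (Z *v c) * x))"
    by (simp add: half_hess_def Z_def diag_mult_vec flip: matrix_vector_mul_assoc)
  also have "\<alpha> * (Z *v c) * x = (Z *v c) * (\<alpha> * x)"
    by (simp add: mult_ac)
  finally show ?thesis
    by (simp add: inner_vec_def mult_ac)
qed

lemma bounded_linear_diag_mult: "bounded_linear (\<lambda>h. diag (h * \<alpha>))"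
  unfolding linear_conv_bounded_linear[symmetric]
  by (intro linearI) (simp_all add: diag_def vec_eq_iff distrib_right)

lemma has_derivative_inv_Ymat:
  assumes inv: "invertible (Ymat W \<beta> \<alpha> y)"
  shows "((\<lambda>y. matrix_inv (Ymat W \<beta> \<alpha> y)) has_derivative
    (\<lambda>h. - (matrix_inv (Ymat W \<beta> \<alpha> y) ** diag (h * \<alpha>) ** matrix_inv (Ymat W \<beta> \<alpha> y)))) (at y)"
proof -
  have "((\<lambda>y. laplacian_loop W \<beta> + diag (y * \<alpha>)) has_derivative (\<lambda>h. 0 + diag (h * \<alpha>))) (at y)"
    by (intro has_derivative_add has_derivative_const bounded_linear_imp_has_derivative
        bounded_linear_diag_mult)
  then have "(Ymat W \<beta> \<alpha> has_derivative (\<lambda>h. diag (h * \<alpha>))) (at y)"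
    by (simp add: Ymat_def[abs_def])
  from has_derivative_compose[OF this has_derivative_matrix_inv[OF inv]] show ?thesis .
qed

lemma gderiv_objective:
  assumes inv: "invertible (Ymat W \<beta> \<alpha> y)"
  shows "GDERIV (\<lambda>y. b \<bullet> (matrix_inv (Ymat W \<beta> \<alpha> y) *v c)) y :> grad_formula W \<beta> \<alpha> b c y"
proof -
  let ?Z = "matrix_inv (Ymat W \<beta> \<alpha> y)"
  have "bounded_linear (\<lambda>A. b \<bullet> (A *v c))"
    by (intro bounded_linear_compose[OF bounded_linear_inner_right]
        bounded_bilinear.bounded_linear_left[OF bounded_bilinear_matrix_vector_mult])
  then have "((\<lambda>y. b \<bullet> (matrix_inv (Ymat W \<beta> \<alpha> y) *v c)) has_derivative
      (\<lambda>h. b \<bullet> (- (?Z ** diag (h * \<alpha>) ** ?Z) *v c))) (at y)"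
    by (rule bounded_linear.has_derivative[OF _ has_derivative_inv_Ymat[OF inv]])
  also have "(\<lambda>h. b \<bullet> (- (?Z ** diag (h * \<alpha>) ** ?Z) *v c))
      = (\<lambda>h. h \<bullet> grad_formula W \<beta> \<alpha> b c y)"
  proof
    fix h
    have "b \<bullet> (- (?Z ** diag (h * \<alpha>) ** ?Z) *v c) = - (b \<bullet> (?Z *v (h * \<alpha> * (?Z *v c))))"
      by (simp add: bounded_bilinear.minus_left[OF bounded_bilinear_matrix_vector_mult]
          diag_mult_vec flip: matrix_vector_mul_assoc)
    also have "\<dots> = - ((b v* ?Z) \<bullet> (h * \<alpha> * (?Z *v c)))"
      by (simp add: dot_lmul_matrix)
    also have "\<dots> = h \<bullet> grad_formula W \<beta> \<alpha> b c y"
      by (simp add: grad_formula_def inner_vec_def sum_negf mult_ac)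
    finally show "b \<bullet> (- (?Z ** diag (h * \<alpha>) ** ?Z) *v c) = h \<bullet> grad_formula W \<beta> \<alpha> b c y" .
  qed
  finally show ?thesis
    by (simp add: gderiv_def)
qed

text \<open>The constant sits in the middle, like \<alpha> in \<open>grad_formula\<close>, so that
  the bilinear product rule applies directly.\<close>

lemma bounded_bilinear_hadamard: "bounded_bilinear (\<lambda>x y. x * a * (y :: real^'n))"
  unfolding bilinear_conv_bounded_bilinear[symmetric] bilinear_def
  by (auto intro!: linearI simp: vec_eq_iff algebra_simps)

text \<open>In the product rule, differentiating the right factor \<open>Z *v c\<close>, with
  \<open>Z\<close> the inverse, gives \<open>half_hess\<close>, and differentiating the left factor
  \<open>b v* Z\<close> gives its transpose.\<close>

lemma has_derivative_grad_formula:
  fixes W :: "real^'n^'n"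
  assumes inv: "invertible (Ymat W \<beta> \<alpha> y)"
  shows "(grad_formula W \<beta> \<alpha> b c has_derivative (*v) (hess_formula W \<beta> \<alpha> b c y)) (at y)"
proof -
  let ?Z = "\<lambda>y. matrix_inv (Ymat W \<beta> \<alpha> y)"
  let ?D = "\<lambda>h. ?Z y ** diag (h * \<alpha>) ** ?Z y"
  have "bounded_linear (\<lambda>A :: real^'n^'n. b v* A)"
    unfolding linear_conv_bounded_linear[symmetric]
    by (intro linearI) (simp_all add: vector_matrix_mult_def vec_eq_iff sum.distrib sum_distrib_left algebra_simps)
  then have p: "((\<lambda>y. b v* ?Z y) has_derivative (\<lambda>h. b v* (- ?D h))) (at y)"
    by (rule bounded_linear.has_derivative[OF _ has_derivative_inv_Ymat[OF inv]])
  have q: "((\<lambda>y. ?Z y *v c) has_derivative (\<lambda>h. - ?D h *v c)) (at y)"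
    by (rule bounded_linear.has_derivative[OF bounded_bilinear.bounded_linear_left[OF
          bounded_bilinear_matrix_vector_mult] has_derivative_inv_Ymat[OF inv]])
  have "((\<lambda>y. - ((b v* ?Z y) * \<alpha> * (?Z y *v c))) has_derivative
      (\<lambda>h. - ((b v* ?Z y) * \<alpha> * (- ?D h *v c) + (b v* (- ?D h)) * \<alpha> * (?Z y *v c)))) (at y)"
    by (intro has_derivative_minus bounded_bilinear.FDERIV[OF bounded_bilinear_hadamard p q])
  also have "(\<lambda>h. - ((b v* ?Z y) * \<alpha> * (- ?D h *v c) + (b v* (- ?D h)) * \<alpha> * (?Z y *v c)))
      = (*v) (hess_formula W \<beta> \<alpha> b c y)"
  proof
    fix h
    have Dc: "- ?D h *v c = - (?Z y *v (h * \<alpha> * (?Z y *v c)))"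
      by (simp add: bounded_bilinear.minus_left[OF bounded_bilinear_matrix_vector_mult]
          diag_mult_vec flip: matrix_vector_mul_assoc)
    have "b v* (- ?D h) = - (b v* ?D h)"
      by (simp add: vector_matrix_mult_def vec_eq_iff sum_negf)
    then have bD: "b v* (- ?D h) = - ((b v* ?Z y) * (h * \<alpha>) v* ?Z y)"
      by (simp add: vec_mult_diag flip: vector_matrix_mul_assoc)
    define p where "p = b v* ?Z y"
    define q where "q = ?Z y *v c"
    show "- ((b v* ?Z y) * \<alpha> * (- ?D h *v c) + (b v* (- ?D h)) * \<alpha> * (?Z y *v c))
        = hess_formula W \<beta> \<alpha> b c y *v h"
      unfolding Dc bD
      unfolding vec_eq_iff matrix_vector_mult_def[of "hess_formula W \<beta> \<alpha> b c y"] hess_formula_nth half_hess_nth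
        p_def[symmetric] q_def[symmetric]
      by (simp add: matrix_vector_mult_def vector_matrix_mult_def sum_distrib_left sum_distrib_right
          sum.distrib distrib_left distrib_right mult_ac)
  qed
  finally show ?thesis
    by (simp add: grad_formula_def[abs_def])
qed

text \<open>The derivative is a product of the inverse with itself and constants, so class k of the
  inverse gives class k + 1.\<close>

lemma Ck_on_inv_Ymat:
  assumes S: "open S" and inv: "\<And>y. y \<in> S \<Longrightarrow> invertible (Ymat W \<beta> \<alpha> y)"
  shows "Ck_on k S (\<lambda>y. matrix_inv (Ymat W \<beta> \<alpha> y))"
proof (induction k)
  case 0
  show ?case
    using has_derivative_continuous[OF has_derivative_inv_Ymat[OF inv]]
    by (auto intro: continuous_at_imp_continuous_on)
next
  case (Suc k)
  note mult = bounded_bilinear.Ck_on[OF bounded_bilinear_matrix_matrix_mult S]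
  show ?case
    by (rule Ck_on_SucI[OF S has_derivative_inv_Ymat[OF inv]])
      (assumption | intro bounded_linear.Ck_on[OF bounded_linear_minus[OF bounded_linear_ident] S]
        mult Suc.IH Ck_on_const[OF S])+
qed

lemma smooth_on_objective:
  assumes S: "open S" and inv: "\<And>y. y \<in> S \<Longrightarrow> invertible (Ymat W \<beta> \<alpha> y)"
  shows "smooth_on S (\<lambda>y. b \<bullet> (matrix_inv (Ymat W \<beta> \<alpha> y) *v c))"
proof -
  have "bounded_linear (\<lambda>A. b \<bullet> (A *v c))"
    by (intro bounded_linear_compose[OF bounded_linear_inner_right]
        bounded_bilinear.bounded_linear_left[OF bounded_bilinear_matrix_vector_mult])
  then show ?thesis
    unfolding smooth_on_def using bounded_linear.Ck_on[OF _ S Ck_on_inv_Ymat[OF S inv]] by blast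
qed

text \<open>The second derivative along the segment is the Hessian form in direction
  \<open>y - x\<close>. Nonsingularity is asked on the segment alone, since the cube may contain
  points where \<open>Ymat\<close> is singular.\<close>

lemma convex_on_objective_segment:
  fixes x y :: "real^'n"
  defines "\<gamma> t \<equiv> x + t *\<^sub>R (y - x)"
  assumes inv: "\<And>t. t \<in> {0..1} \<Longrightarrow> invertible (Ymat W \<beta> \<alpha> (\<gamma> t))"
    and psd: "\<And>t z. t \<in> {0..1} \<Longrightarrow> 0 \<le> z \<bullet> (hess_formula W \<beta> \<alpha> b c (\<gamma> t) *v z)"
  shows "convex_on {0..1} (\<lambda>t. b \<bullet> (matrix_inv (Ymat W \<beta> \<alpha> (\<gamma> t)) *v c))"
proof (rule f''_ge0_imp_convex)
  have \<gamma>: "(\<gamma> has_derivative (\<lambda>t. t *\<^sub>R (y - x))) (at t)" for t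
    unfolding \<gamma>_def[abs_def] by (auto intro!: derivative_eq_intros)
  show "((\<lambda>t. b \<bullet> (matrix_inv (Ymat W \<beta> \<alpha> (\<gamma> t)) *v c)) has_real_derivative
      (y - x) \<bullet> grad_formula W \<beta> \<alpha> b c (\<gamma> t)) (at t)" if t: "t \<in> {0..1}" for t
    using has_derivative_compose[OF \<gamma> gderiv_objective[OF inv[OF t], unfolded gderiv_def]]
    by (rule has_derivative_imp_has_field_derivative) simp
  show "((\<lambda>t. (y - x) \<bullet> grad_formula W \<beta> \<alpha> b c (\<gamma> t)) has_real_derivative
      (y - x) \<bullet> (hess_formula W \<beta> \<alpha> b c (\<gamma> t) *v (y - x))) (at t)" if t: "t \<in> {0..1}" for t
    using has_derivative_inner_right[OF has_derivative_compose[OF \<gamma> has_derivative_grad_formula[OF inv[OF t]]]]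
    by (rule has_derivative_imp_has_field_derivative) (simp add: matrix_vector_mult_scaleR)
qed (use psd in auto)

text \<open>Passing to absolute values preserves the norm of \<open>x\<close>, so an entrywise bound
  carries over to maximal Rayleigh quotients.\<close>

lemma quadratic_form_mono:
  fixes A B :: "real^'n^'n"
  assumes "\<And>i j. 0 \<le> A $ i $ j" "\<And>i j. A $ i $ j \<le> B $ i $ j"
  shows "x \<bullet> (A *v x) \<le> (\<chi> i. \<bar>x $ i\<bar>) \<bullet> (B *v (\<chi> i. \<bar>x $ i\<bar>))"
proof -
  have "x $ i * (A $ i $ j * x $ j) \<le> \<bar>x $ i\<bar> * (B $ i $ j * \<bar>x $ j\<bar>)" for i j
  proof -
    have "x $ i * (A $ i $ j * x $ j) \<le> \<bar>x $ i * (A $ i $ j * x $ j)\<bar>"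
      by (rule abs_ge_self)
    also have "\<dots> = \<bar>x $ i\<bar> * (A $ i $ j * \<bar>x $ j\<bar>)"
      using assms(1)[of i j] by (simp add: abs_mult)
    also have "\<dots> \<le> \<bar>x $ i\<bar> * (B $ i $ j * \<bar>x $ j\<bar>)"
      by (intro mult_left_mono mult_right_mono assms(2)) auto
    finally show ?thesis .
  qed
  then show ?thesis
    by (simp add: inner_vec_def matrix_vector_mult_def sum_distrib_left sum_mono)
qed

section \<open>Signs, monotonicity and semidefiniteness for irreducible weights\<close>

context irreducible_weights
begin

context
  fixes \<alpha> \<beta> b c :: "real^'n"
  assumes \<alpha>: "0 \<le> \<alpha>" and b: "0 \<le> b" "b \<noteq> 0" and c: "0 \<le> c" "c \<noteq> 0"
begin

lemma inner_inv_pos: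
  assumes "0 \<le> d" "d \<noteq> 0"
  shows "0 < b \<bullet> (matrix_inv (laplacian_loop W d) *v c)"
proof -
  obtain i where "0 < b $ i"
    using b by (metis less_eq_vec_def order_le_less vec_eq_iff zero_index)
  then show ?thesis
    unfolding inner_vec_def using b(1) inv_mult_vec_pos[OF assms c]
    by (auto intro!: sum_pos2[of _ i] mult_nonneg_nonneg simp: less_eq_vec_def less_imp_le)
qed

lemma inner_inv_antimono:
  assumes "0 \<le> d" "d \<noteq> 0" "d \<le> e"
  shows "b \<bullet> (matrix_inv (laplacian_loop W e) *v c) \<le> b \<bullet> (matrix_inv (laplacian_loop W d) *v c)"
  unfolding inner_vec_def matrix_vector_mult_def using b(1) c(1)
  by (auto intro!: sum_mono mult_left_mono mult_right_mono inv_antimono[OF assms] simp: less_eq_vec_def)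

lemma half_hess_nonneg:
  assumes "0 \<le> \<beta> + y * \<alpha>" "\<beta> + y * \<alpha> \<noteq> 0"
  shows "0 \<le> half_hess W \<beta> \<alpha> b c y $ i $ j"
  using \<alpha> inv_pos[OF assms, of i j] inv_mult_vec_pos[OF assms c, of j] vec_mult_inv_pos[OF assms b, of i]
  by (simp add: half_hess_nth Ymat_eq_laplacian_loop less_eq_vec_def)

text \<open>Apart from the fixed \<alpha>, each entry is a product of three positive factors, all
  decreasing as the loop weights grow.\<close>

lemma half_hess_antimono:
  assumes d: "0 \<le> \<beta> + y * \<alpha>" "\<beta> + y * \<alpha> \<noteq> 0" and e: "\<beta> + y * \<alpha> \<le> \<beta> + z * \<alpha>"
  shows "half_hess W \<beta> \<alpha> b c z $ i $ j \<le> half_hess W \<beta> \<alpha> b c y $ i $ j"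
proof -
  let ?D = "matrix_inv (laplacian_loop W (\<beta> + y * \<alpha>))" and ?E = "matrix_inv (laplacian_loop W (\<beta> + z * \<alpha>))"
  have e0: "0 \<le> \<beta> + z * \<alpha>"
    using d(1) e by (rule order_trans)
  have e1: "\<beta> + z * \<alpha> \<noteq> 0"
    using d e by (metis antisym)
  note e0 = e0 e1
  have "(b v* ?E) $ i \<le> (b v* ?D) $ i"
    unfolding vector_matrix_mult_def using b(1)
    by (auto intro!: sum_mono mult_left_mono mult_right_mono inv_antimono[OF d e] simp: less_eq_vec_def)
  moreover have "(?E *v c) $ j \<le> (?D *v c) $ j"
    unfolding matrix_vector_mult_def using c(1)
    by (auto intro!: sum_mono mult_left_mono mult_right_mono inv_antimono[OF d e] simp: less_eq_vec_def)
  ultimately show ?thesis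
    unfolding half_hess_nth Ymat_eq_laplacian_loop vector_mult_component
    using \<alpha> inv_antimono[OF d e] inv_pos[OF e0, of i j] inv_mult_vec_pos[OF e0 c, of j]
      vec_mult_inv_pos[OF e0 b, of i] inv_pos[OF d, of i j] vec_mult_inv_pos[OF d b, of i]
    by (intro mult_mono mult_left_mono mult_nonneg_nonneg) (auto simp: less_eq_vec_def less_imp_le)
qed

lemma hess_formula_psd:
  assumes d: "0 \<le> \<beta> + y * \<alpha>" "\<beta> + y * \<alpha> \<noteq> 0"
  shows "0 \<le> x \<bullet> (hess_formula W \<beta> \<alpha> b c y *v x)"
proof -
  let ?Y = "laplacian_loop W (\<beta> + y * \<alpha>)"
  have "0 \<le> (\<alpha> * x) \<bullet> ((b v* matrix_inv ?Y) * (matrix_inv ?Y *v ((matrix_inv ?Y *v c) * (\<alpha> * x))))"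
  proof (rule quadratic_form_inverse_nonneg[OF _ _ b(1) c(1) refl _ refl])
    show "invertible ?Y"
      using d by (simp add: invertible_laplacian_loop_iff)
    show "?Y $ i $ j \<le> 0" if "i \<noteq> j" for i j
      using that nonneg by (simp add: laplacian_loop_off_diag)
    show "0 \<le> b v* matrix_inv ?Y"
      using vec_mult_inv_pos[OF d b] by (simp add: less_eq_vec_def less_imp_le)
  qed (rule inv_mult_vec_pos[OF d c])
  then show ?thesis
    by (simp add: hess_formula_quadratic_form Ymat_eq_laplacian_loop)
qed

end

end

subsection \<open>The objective on the unit cube\<close>

text \<open>The right-hand side is \<infinity>, because the second term is nonnegative. This settles
  convexity when an endpoint has infinite value.\<close>

lemma ereal_pos_convex_infinite:
  assumes "0 < u" "0 \<le> v" "0 \<le> (a :: ereal)"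
  shows "(z :: ereal) \<le> ereal u * \<infinity> + ereal v * a"
  using assms by (cases a) auto

lemma irreducible_weights_strongly_connected:
  fixes G :: "'n::finite pair_pre_digraph" and W :: "real^'n^'n"
  assumes G: "pverts G = UNIV" "strongly_connected (with_proj G)"
    and W: "0 \<le> W" "\<And>i j. i \<noteq> j \<Longrightarrow> (i, j) \<in> parcs G \<Longrightarrow> W $ i $ j > 0"
  shows "irreducible_weights W"
proof
  show "0 \<le> W $ i $ j" for i j
    using W(1) by (simp add: less_eq_vec_def)
  show "(i, j) \<in> {(i, j). 0 < W $ i $ j}\<^sup>*" for i j
  proof -
    have "i \<rightarrow>\<^sup>*\<^bsub>with_proj G\<^esub> j"
      using G by (simp add: strongly_connected_def)
    then have "(i, j) \<in> (parcs G)\<^sup>*"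
      using reachable_rtranclI by fastforce
    then show ?thesis
    proof (induction rule: rtrancl_induct)
      case (step k l)
      then show ?case
        \<comment> \<open>A loop arc leaves the endpoint unchanged, so the path found so far serves;
          any other arc has positive weight.\<close>
        using W(2)[of k l] by (cases "k = l") (auto intro: rtrancl_into_rtrancl)
    qed simp
  qed
qed

theorem theorem2:
  fixes G :: "'n::finite pair_pre_digraph"
    and W :: "real^'n^'n"
    and b c \<alpha> \<beta> :: "real^'n"
  assumes "pverts G = UNIV"
    and "strongly_connected (with_proj G)"
    and "0 \<le> W"
    and "\<And>i j. i \<noteq> j \<Longrightarrow> (i, j) \<in> parcs G \<Longrightarrow> W $ i $ j > 0"
    and "\<And>i j. i \<noteq> j \<Longrightarrow> (i, j) \<notin> parcs G \<Longrightarrow> W $ i $ j = 0"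
    and "\<exists>i. W $ i $ i > 0"
    and "0 \<le> b" "b \<noteq> 0"
    and "0 \<le> c" "c \<noteq> 0"
    and "0 \<le> \<alpha>" "\<alpha> \<noteq> 0"
    and "0 \<le> \<beta>"
  shows
    "let \<Omega> = {0..1};
         Y = Ymat W \<beta> \<alpha>;
         f = objective W \<beta> \<alpha> b c;
         H = hess_formula W \<beta> \<alpha> b c;
         L\<^sub>f = spectral_radius (H 0)
     in (\<forall>y\<in>\<Omega>. 0 < f y)
      \<and> ereal_convex_on \<Omega> f
      \<and> antimono_on \<Omega> f
      \<and> (\<forall>y\<in>interior \<Omega>. f y \<noteq> \<infinity>)
      \<and> smooth_on (interior \<Omega>) (\<lambda>y. real_of_ereal (f y))
      \<and> (\<forall>y\<in>interior \<Omega>. GDERIV (\<lambda>y. real_of_ereal (f y)) y :> grad_formula W \<beta> \<alpha> b c y)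
      \<and> (\<forall>y\<in>interior \<Omega>. has_hessian (\<lambda>y. real_of_ereal (f y)) (H y) y)
      \<and> (\<forall>y\<in>\<Omega>. invertible (Y y) \<longrightarrow>
            0 \<le> H y \<and> loewner_le 0 (H y) \<and> (\<beta> \<noteq> 0 \<longrightarrow> loewner_le (H y) (L\<^sub>f *\<^sub>R mat 1)))
      \<and> (\<beta> \<noteq> 0 \<longrightarrow> L\<^sub>f \<le> real CARD('n) * Max {H 0 $ i $ j | i j. True})"
proof -
  interpret irreducible_weights W
    by (rule irreducible_weights_strongly_connected[OF assms(1-4)])
  note b = assms(7,8) and c = assms(9,10) and \<alpha> = assms(11,12) and \<beta> = assms(13)
  note setting = \<alpha>(1) b c
  define \<Omega> where "\<Omega> = {0..1 :: real^'n}"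
  define Y where "Y = Ymat W \<beta> \<alpha>"
  define f where "f = objective W \<beta> \<alpha> b c"
  define H where "H = hess_formula W \<beta> \<alpha> b c"
  define d where "d y = \<beta> + y * \<alpha>" for y
  define \<phi> where "\<phi> y = b \<bullet> (matrix_inv (Y y) *v c)" for y
  have Y: "Y y = laplacian_loop W (d y)" for y
    by (simp add: Y_def d_def Ymat_eq_laplacian_loop)
  have d: "0 \<le> d y" if "0 \<le> y" for y
    using that \<alpha> \<beta> by (simp add: d_def less_eq_vec_def)
  have inv: "invertible (Y y) \<longleftrightarrow> d y \<noteq> 0" if "0 \<le> y" for y
    using invertible_laplacian_loop_iff[OF d[OF that]] by (simp add: Y)
  have f: "f y = (if d y \<noteq> 0 then ereal (\<phi> y) else \<infinity>)" if "0 \<le> y" for y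
    using inv[OF that] by (simp add: f_def objective_def \<phi>_def Y_def)
  have pos: "0 < f y" if "0 \<le> y" for y
    using inner_inv_pos[OF setting d[OF that]] by (simp add: f[OF that] \<phi>_def Y)
  have psd: "0 \<le> x \<bullet> (H y *v x)" if "0 \<le> y" "d y \<noteq> 0" for x y
    using hess_formula_psd[OF setting, of \<beta> y x] that d[of y] by (simp add: H_def d_def)
  have H_nonneg: "0 \<le> H y $ i $ j" if "0 \<le> y" "d y \<noteq> 0" for y i j
    using half_hess_nonneg[OF setting, of \<beta> y] that d[of y]
    by (simp add: H_def hess_formula_nth d_def)
  have H_sym: "transpose (H y) = H y" for y
    by (simp add: H_def transpose_hess_formula)

  have "ereal_convex_on \<Omega> f"
    unfolding ereal_convex_on_def
  proof (intro conjI ballI allI impI)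
    show "convex \<Omega>"
      by (simp add: \<Omega>_def interval_cbox_cart)
  next
    fix x y :: "real^'n" and u v :: real
    assume "x \<in> \<Omega>" "y \<in> \<Omega>" and u: "0 \<le> u" and v: "0 \<le> v" and uv: "u + v = 1"
    then have x: "0 \<le> x" and y: "0 \<le> y"
      by (simp_all add: \<Omega>_def)
    show "f (u *\<^sub>R x + v *\<^sub>R y) \<le> ereal u * f x + ereal v * f y"
    proof (cases "u = 0 \<or> v = 0")
      \<comment> \<open>At an endpoint both sides agree, as \<open>0 * \<infinity> = 0\<close>
        discards the other value.\<close>
      case True
      then show ?thesis
        using uv by (auto simp flip: zero_ereal_def)
    next
      case False
      then have u: "0 < u" and v: "0 < v"
        using u v by auto
      show ?thesis
      proof (cases "d x = 0 \<or> d y = 0")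
        case True
        then show ?thesis
          using ereal_pos_convex_infinite[of u v "f y"] ereal_pos_convex_infinite[of v u "f x"] u v
            pos[OF x] pos[OF y] f[OF x] f[OF y]
          by (auto simp: add.commute)
      next
        case False
        let ?\<gamma> = "\<lambda>t. x + t *\<^sub>R (y - x)"
        have \<gamma>: "0 \<le> ?\<gamma> t" "d (?\<gamma> t) \<noteq> 0" if t: "t \<in> {0..1}" for t
        proof -
          have eq: "?\<gamma> t = (1 - t) *\<^sub>R x + t *\<^sub>R y"
            by (simp add: algebra_simps)
          show "0 \<le> ?\<gamma> t"
            unfolding eq using t x y by (simp add: less_eq_vec_def)
          \<comment> \<open>\<open>d\<close> is affine, and nonnegative vectors sum to zero only if
            both vanish; as \<open>1 - t\<close> and \<open>t\<close> are not both zero,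
            \<open>d\<close> would vanish at an endpoint.\<close>
          have "d (?\<gamma> t) = (1 - t) *\<^sub>R d x + t *\<^sub>R d y"
            by (simp add: d_def vec_eq_iff algebra_simps)
          moreover have "0 \<le> (1 - t) *\<^sub>R d x" "0 \<le> t *\<^sub>R d y"
            using t d[OF x] d[OF y] by (simp_all add: less_eq_vec_def)
          ultimately have "d (?\<gamma> t) = 0 \<longleftrightarrow> (1 - t) *\<^sub>R d x = 0 \<and> t *\<^sub>R d y = 0"
            by (simp add: add_nonneg_eq_0_iff)
          then show "d (?\<gamma> t) \<noteq> 0"
            using False by auto
        qed
        have "convex_on {0..1} (\<lambda>t. b \<bullet> (matrix_inv (Ymat W \<beta> \<alpha> (?\<gamma> t)) *v c))"
          by (rule convex_on_objective_segment) (use \<gamma> inv psd in \<open>auto simp: Y_def H_def\<close>)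
        \<comment> \<open>Convexity is applied between 0 and 1 at parameter \<open>v\<close>, where
          the segment passes through \<open>u *\<^sub>R x + v *\<^sub>R y\<close>.\<close>
        then have "\<phi> (?\<gamma> ((1 - v) *\<^sub>R 0 + v *\<^sub>R 1)) \<le> (1 - v) * \<phi> (?\<gamma> 0) + v * \<phi> (?\<gamma> 1)"
          unfolding \<phi>_def Y_def by (rule convex_onD) (use u v uv in auto)
        moreover have u_eq: "u = 1 - v"
          using uv by simp
        moreover have \<gamma>_v: "?\<gamma> v = u *\<^sub>R x + v *\<^sub>R y"
          unfolding u_eq by (simp add: algebra_simps)
        ultimately have "\<phi> (u *\<^sub>R x + v *\<^sub>R y) \<le> u * \<phi> x + v * \<phi> y"
          by simp
        moreover have "f (u *\<^sub>R x + v *\<^sub>R y) = ereal (\<phi> (u *\<^sub>R x + v *\<^sub>R y))"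
          using f[OF \<gamma>(1)[of v]] \<gamma>(2)[of v] \<gamma>_v u v uv by simp
        ultimately show ?thesis
          using False f[OF x] f[OF y] by simp
      qed
    qed
  qed

  moreover have "antimono_on \<Omega> f"
  proof (rule monotone_onI)
    fix x y :: "real^'n"
    assume "x \<in> \<Omega>" "y \<in> \<Omega>" and xy: "x \<le> y"
    then have x: "0 \<le> x" and y: "0 \<le> y"
      by (simp_all add: \<Omega>_def)
    have dxy: "d x \<le> d y"
      using xy \<alpha> by (simp add: d_def less_eq_vec_def mult_right_mono)
    show "f y \<le> f x"
    proof (cases "d x = 0")
      case False
      then have "d y \<noteq> 0"
        using dxy d[OF x] by (metis antisym)
      then show ?thesis
        using False inner_inv_antimono[OF setting d[OF x] False dxy]
        by (simp add: f[OF x] f[OF y] \<phi>_def Y)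
    qed (simp add: f[OF x])
  qed

  moreover have int: "0 \<le> y \<and> d y \<noteq> 0 \<and> f y = ereal (\<phi> y)" if y: "y \<in> interior \<Omega>" for y
  proof -
    have y0: "0 < y $ i" for i
      using y by (simp add: \<Omega>_def interval_cbox_cart interior_cbox mem_box_cart)
    \<comment> \<open>All coordinates of \<open>y\<close> are positive, so one positive entry of
      \<alpha> makes \<open>d y\<close> nonzero even for \<beta> = 0.\<close>
    obtain i where "0 < \<alpha> $ i"
      using \<alpha> by (metis less_eq_vec_def order_le_less vec_eq_iff zero_index)
    then have "0 < d y $ i"
      using \<beta> y0[of i] by (simp add: d_def less_eq_vec_def add_nonneg_pos)
    then have "d y \<noteq> 0"
      by auto
    moreover have "0 \<le> y"
      using y0 by (simp add: less_eq_vec_def less_imp_le)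
    ultimately show ?thesis
      using f by simp
  qed
  then have "\<forall>y\<in>interior \<Omega>. f y \<noteq> \<infinity>"
    by auto

  moreover have int_inv: "invertible (Ymat W \<beta> \<alpha> y)" if "y \<in> interior \<Omega>" for y
    using int[OF that] inv by (simp add: Y_def)
  have \<phi>_eq: "\<phi> = (\<lambda>y. b \<bullet> (matrix_inv (Ymat W \<beta> \<alpha> y) *v c))"
    by (simp add: \<phi>_def Y_def fun_eq_iff)
  have real_f: "\<phi> y = real_of_ereal (f y)" if "y \<in> interior \<Omega>" for y
    using int[OF that] by simp
  have "smooth_on (interior \<Omega>) \<phi>"
    unfolding \<phi>_eq by (rule smooth_on_objective[OF open_interior int_inv])
  then have "smooth_on (interior \<Omega>) (\<lambda>y. real_of_ereal (f y))"
    unfolding smooth_on_def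
    using Ck_on_cong[OF open_interior, of \<Omega> \<phi> "\<lambda>y. real_of_ereal (f y)"] real_f by simp

  moreover have grad: "GDERIV (\<lambda>y. real_of_ereal (f y)) y :> grad_formula W \<beta> \<alpha> b c y"
    if y: "y \<in> interior \<Omega>" for y
  proof -
    have "GDERIV \<phi> y :> grad_formula W \<beta> \<alpha> b c y"
      unfolding \<phi>_eq by (rule gderiv_objective[OF int_inv[OF y]])
    then show ?thesis
      unfolding gderiv_def by (rule has_derivative_transform_within_open[OF _ open_interior y real_f])
  qed

  moreover have "has_hessian (\<lambda>y. real_of_ereal (f y)) (H y) y" if y: "y \<in> interior \<Omega>" for y
  proof -
    \<comment> \<open>\<open>has_hessian\<close> asks for the gradient on a neighbourhood, which the
      open interior supplies.\<close>
    have "\<forall>\<^sub>F z in nhds y. z \<in> interior \<Omega>"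
      using y by (intro eventually_nhds_in_open) auto
    then have "\<forall>\<^sub>F z in nhds y. GDERIV (\<lambda>y. real_of_ereal (f y)) z :> grad_formula W \<beta> \<alpha> b c z"
      by (rule eventually_mono) (rule grad)
    then show ?thesis
      unfolding has_hessian_def H_def using has_derivative_grad_formula[OF int_inv[OF y]] by blast
  qed

  moreover have "0 \<le> H y \<and> loewner_le 0 (H y) \<and>
      (\<beta> \<noteq> 0 \<longrightarrow> loewner_le (H y) (spectral_radius (H 0) *\<^sub>R mat 1))"
    if "y \<in> \<Omega>" "invertible (Y y)" for y
  proof (intro conjI impI)
    have y: "0 \<le> y" "d y \<noteq> 0"
      using that inv by (auto simp: \<Omega>_def)
    show "0 \<le> H y"
      using H_nonneg[OF y] by (simp add: less_eq_vec_def)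
    show "loewner_le 0 (H y)"
      unfolding loewner_le_def using psd[OF y] H_sym by (simp add: transpose_def vec_eq_iff)
    assume "\<beta> \<noteq> 0"
    \<comment> \<open>With \<beta> nonzero, \<open>Y 0\<close> is nonsingular and 0 is the least
      point of the cube; \<open>0 * \<alpha>\<close> stays unsimplified to match
      \<open>half_hess_antimono\<close>.\<close>
    have d0: "0 \<le> \<beta> + 0 * \<alpha>" "\<beta> + 0 * \<alpha> \<noteq> 0" "\<beta> + 0 * \<alpha> \<le> \<beta> + y * \<alpha>"
      using \<beta> \<open>\<beta> \<noteq> 0\<close> y \<alpha> by (simp_all add: less_eq_vec_def)
    have "H y $ i $ j \<le> H 0 $ i $ j" for i j
      unfolding H_def hess_formula_nth by (intro add_mono half_hess_antimono[OF setting d0])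
    note le = quadratic_form_mono[OF H_nonneg[OF y] this]
    have "x \<bullet> (H y *v x) \<le> spectral_radius (H 0) * (x \<bullet> x)" for x
    proof -
      have "x \<bullet> (H y *v x) \<le> spectral_radius (H 0) * ((\<chi> i. \<bar>x $ i\<bar>) \<bullet> (\<chi> i. \<bar>x $ i\<bar>))"
        using le quadratic_form_le_spectral_radius[OF H_sym] by (rule order_trans)
      also have "(\<chi> i. \<bar>x $ i\<bar>) \<bullet> (\<chi> i. \<bar>x $ i\<bar>) = x \<bullet> x"
        by (simp add: inner_vec_def)
      finally show ?thesis .
    qed
    then have "0 \<le> x \<bullet> ((spectral_radius (H 0) *\<^sub>R mat 1 - H y) *v x)" for x
      by (simp add: matrix_vector_mult_diff_rdistrib inner_diff_right flip: scaleR_matrix_vector_assoc)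
    then show "loewner_le (H y) (spectral_radius (H 0) *\<^sub>R mat 1)"
      unfolding loewner_le_def using H_sym by (simp add: transpose_scalar)
  qed

  moreover have "spectral_radius (H 0) \<le> real CARD('n) * Max {H 0 $ i $ j | i j. True}" if "\<beta> \<noteq> 0"
  proof (rule spectral_radius_le_symmetric[OF H_sym])
    fix i j
    have "{H 0 $ i $ j | i j. True} = (\<lambda>(i, j). H 0 $ i $ j) ` UNIV"
      by auto
    then have "H 0 $ i $ j \<le> Max {H 0 $ i $ j | i j. True}"
      by (intro Max_ge) auto
    \<comment> \<open>Nonnegativity of the entries lets their maximum bound the absolute values as
      well.\<close>
    moreover have "0 \<le> H 0 $ i $ j"
      using that by (intro H_nonneg) (simp_all add: d_def)
    ultimately show "\<bar>H 0 $ i $ j\<bar> \<le> Max {H 0 $ i $ j | i j. True}"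
      by simp
  qed

  ultimately show ?thesis
    using pos unfolding Let_def \<Omega>_def Y_def f_def H_def by simp
qed

end
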